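(* Let $\mathcal T$ be a (finite) shellable $n$-dimensional triangulation in $\mathbb R^n$, let the domain $\Omega\subseteq\mathbb R^n$ be the interior of the underlying set of $\mathcal T$, and let $T_0,T_1,\dots,T_M$ be a shelling of $\mathcal T$. Let $1\le p\le\infty$, let $q\in[1,\infty]$ satisfy $1=1/p+1/q$, and suppose that $u,w\in W^p\Lambda^k(\Omega)$ satisfy $dw=du$ and, with nonnegative constants $A_{m,\ell}$ ($0\le\ell\le m\le M$) and $B_{m,\ell}$ ($0\le\ell<m\le M$), $$\|w\|_{L^p(T_0)}\le A_{0,0}\|du\|_{L^p(T_0)},$$ $$\|w\|_{L^p(T_m)}\le\sum_{\ell=0}^mA_{m,\ell}\|du\|_{L^p(T_\ell)}+\sum_{\ell=0}^{m-1}B_{m,\ell}\|w\|_{L^p(T_\ell)},\qquad1\le m\le M.$$ Then $$\|w\|_{L^p(\Omega)}\le\left(\sum_{m=0}^M\Big(\sum_{\ell=0}^MC_{m,\ell}^q\Big)^{p/q}\right)^{1/p}\|du\|_{L^p(\Omega)},$$ where $$C_{m,\ell}=\sum_{m=i_L>\dots>i_1\ge\ell}B_{i_L,i_{L-1}}\cdots B_{i_2,i_1}A_{i_1,\ell},$$ the sum running over all $L\ge1$ and all strictly decreasing integer sequences $m=i_L>i_{L-1}>\dots>i_1\ge\ell$ (the product of $B$'s being $1$ for $L=1$, and $C_{m,\ell}=0$ if $\ell>m$). For $p=1$ the constant is read as $\sum_m\max_\ell C_{m,\ell}$ and for $p=\infty$ as $\max_m\sum_\ell C_{m,\ell}$.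
   Context: A triangulation is a finite family of simplices containing all subsimplices of its members and such that any non-empty intersection of two members is a common subsimplex of both; it is $n$-dimensional if every member is contained in an $n$-dimensional member. Its underlying set is the union of its members. A shelling is an enumeration $T_0,\dots,T_M$ of all $n$-simplices such that for each $m\ge1$ the set $(T_0\cup\dots\cup T_{m-1})\cap T_m$ is a triangulated manifold (possibly with boundary) of dimension $n-1$; $\mathcal T$ is shellable if it has a shelling. $L^p\Lambda^k(\Omega)$ is the space of measurable differential $k$-forms on $\Omega$ whose pointwise Euclidean norm is in $L^p$; $W^p\Lambda^k(\Omega)$ consists of those with distributional exterior derivative $du\in L^p\Lambda^{k+1}(\Omega)$. *)

theory Defs
  imports "HOL-Analysis.Analysis" "HOL-Probability.Essential_Supremum"
begin

section \<open>Triangulations and shellings\<close>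

text \<open>
  The library notion \<^const>\<open>simplicial_complex\<close> is closed under all faces in the sense of
  \<^const>\<open>face_of\<close>, which include the empty one. A triangulation in the sense used here consists
  of non-empty simplices, so it is a simplicial complex with its empty face removed: a finite
  family of non-empty simplices that contains the non-empty faces of its members and in which
  two members are either disjoint or meet in a common face.
\<close>

definition simplicial_triangulation :: "'a::euclidean_space set set \<Rightarrow> bool" where
  "simplicial_triangulation \<T> \<longleftrightarrow> {} \<notin> \<T> \<and> simplicial_complex (insert {} \<T>)"

definition dimensional_triangulation :: "nat \<Rightarrow> 'a::euclidean_space set set \<Rightarrow> bool" where
  "dimensional_triangulation d \<T> \<longleftrightarrow>
     simplicial_triangulation \<T> \<and> (\<forall>S\<in>\<T>. \<exists>T\<in>\<T>. int d simplex T \<and> S \<subseteq> T)"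

text \<open>
  The half-space of dimension \<open>d\<close>. Points of \<open>Euclidean_space d\<close> have \<open>x i = 0\<close> for
  \<open>i \<ge> d\<close>; hence for \<open>d = 0\<close> the constraint is void and the half-space is a point.
\<close>

definition half_space :: "nat \<Rightarrow> (nat \<Rightarrow> real) topology" where
  "half_space d = subtopology (Euclidean_space d) {x. 0 \<le> x 0}"

text \<open>
  Topological manifolds, possibly with boundary. The Hausdorff property and second countability
  are automatic for subsets of a Euclidean space.
\<close>

definition manifold_with_boundary :: "nat \<Rightarrow> 'a::euclidean_space set \<Rightarrow> bool" where
  "manifold_with_boundary d X \<longleftrightarrow>
     (\<forall>x\<in>X. \<exists>U V. openin (top_of_set X) U \<and> x \<in> U \<and> openin (half_space d) V \<and>
        top_of_set U homeomorphic_space subtopology (half_space d) V)"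

text \<open>
  The empty set is excluded: it does not count as a manifold of dimension \<open>d\<close>. In a shelling,
  each simplex after the first therefore does meet the union of its predecessors.
\<close>

definition triangulated_manifold :: "nat \<Rightarrow> 'a::euclidean_space set \<Rightarrow> bool" where
  "triangulated_manifold d X \<longleftrightarrow>
     X \<noteq> {} \<and> manifold_with_boundary d X \<and> (\<exists>\<S>. dimensional_triangulation d \<S> \<and> \<Union>\<S> = X)"

definition shelling :: "'a::euclidean_space set set \<Rightarrow> nat \<Rightarrow> (nat \<Rightarrow> 'a set) \<Rightarrow> bool" where
  "shelling \<T> M T \<longleftrightarrow>
     bij_betw T {..M} {S \<in> \<T>. int DIM('a) simplex S} \<and>
     (\<forall>m\<in>{1..M}. triangulated_manifold (DIM('a) - 1) ((\<Union>l<m. T l) \<inter> T m))"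

definition shellable :: "'a::euclidean_space set set \<Rightarrow> bool" where
  "shellable \<T> \<longleftrightarrow> (\<exists>M T. shelling \<T> M T)"

section \<open>Differential forms\<close>

text \<open>
  A \<open>k\<close>-covector is an alternating \<open>k\<close>-linear form, taking its arguments as a list of
  length \<open>k\<close>. The value \<open>0\<close> on lists of other lengths makes equality of covectors
  coincide with equality of functions.
\<close>

type_synonym 'a covector = "'a list \<Rightarrow> real"

definition alternating_form :: "nat \<Rightarrow> 'a::euclidean_space covector \<Rightarrow> bool" where
  "alternating_form k \<omega> \<longleftrightarrow>
     (\<forall>vs. length vs \<noteq> k \<longrightarrow> \<omega> vs = 0) \<and>
     (\<forall>vs i. length vs = k \<and> i < k \<longrightarrow> linear (\<lambda>v. \<omega> (vs[i := v]))) \<and>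
     (\<forall>vs. length vs = k \<and> \<not> distinct vs \<longrightarrow> \<omega> vs = 0)"

text \<open>
  The Euclidean norm on covectors, i.e. the root of the sum of the squared coefficients over all
  strictly increasing multi-indices. The sum below ranges over all multi-indices; those with a
  repeated entry contribute \<open>0\<close>, and each of the others occurs in \<open>fact k\<close> orderings that
  all have the same square.
\<close>

definition covector_norm :: "nat \<Rightarrow> 'a::euclidean_space covector \<Rightarrow> real" where
  "covector_norm k \<omega> = sqrt ((\<Sum>vs | set vs \<subseteq> Basis \<and> length vs = k. (\<omega> vs)\<^sup>2) / fact k)"

section \<open>Lebesgue spaces of differential forms\<close>

definition Lp_norm :: "ennreal \<Rightarrow> nat \<Rightarrow> 'a::euclidean_space set \<Rightarrow> ('a \<Rightarrow> 'a covector) \<Rightarrow> real" where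
  "Lp_norm p k S u =
     (if p = \<infinity> then real_of_ereal (esssup (lebesgue_on S) (\<lambda>x. ereal (covector_norm k (u x))))
      else (\<integral>x. covector_norm k (u x) powr enn2real p \<partial>lebesgue_on S) powr (1 / enn2real p))"

definition Lp_forms :: "ennreal \<Rightarrow> nat \<Rightarrow> 'a::euclidean_space set \<Rightarrow> ('a \<Rightarrow> 'a covector) set" where
  "Lp_forms p k S = {u.
     (\<forall>x\<in>S. alternating_form k (u x)) \<and>
     (\<forall>vs. (\<lambda>x. u x vs) \<in> borel_measurable (lebesgue_on S)) \<and>
     (if p = \<infinity> then \<exists>c. AE x in lebesgue_on S. covector_norm k (u x) \<le> c
      else integrable (lebesgue_on S) (\<lambda>x. covector_norm k (u x) powr enn2real p))}"

section \<open>The distributional exterior derivative\<close>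

primrec Ck :: "nat \<Rightarrow> ('a::euclidean_space \<Rightarrow> real) \<Rightarrow> bool" where
  "Ck 0 f \<longleftrightarrow> continuous_on UNIV f"
| "Ck (Suc j) f \<longleftrightarrow>
     (\<forall>x. f differentiable at x) \<and> (\<forall>v. Ck j (\<lambda>x. frechet_derivative f (at x) v))"

text \<open>
  Functions in \<open>C\<^sub>c\<^sup>\<infinity>(\<Omega>)\<close>, extended by zero to the whole space.
\<close>

definition test_function :: "'a::euclidean_space set \<Rightarrow> ('a \<Rightarrow> real) \<Rightarrow> bool" where
  "test_function \<Omega> \<phi> \<longleftrightarrow>
     (\<forall>j. Ck j \<phi>) \<and> compact (closure {x. \<phi> x \<noteq> 0}) \<and> closure {x. \<phi> x \<noteq> 0} \<subseteq> \<Omega>"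

text \<open>
  For smooth \<open>u\<close> and constant vectors \<open>v\<^sub>0, \<dots>, v\<^sub>k\<close>, the exterior derivative is
  \<open>du(v\<^sub>0, \<dots>, v\<^sub>k) = \<Sum>\<^sub>i (-1)\<^sup>i D\<^bsub>v\<^sub>i\<^esub> (u(v\<^sub>0, \<dots>, v\<^sub>i\<^sub>-\<^sub>1, v\<^sub>i\<^sub>+\<^sub>1, \<dots>, v\<^sub>k))\<close>.
  Here the directional derivatives on the right are taken in the sense of distributions.
\<close>

definition has_weak_exterior_derivative ::
    "'a::euclidean_space set \<Rightarrow> nat \<Rightarrow> ('a \<Rightarrow> 'a covector) \<Rightarrow> ('a \<Rightarrow> 'a covector) \<Rightarrow> bool" where
  "has_weak_exterior_derivative \<Omega> k u du \<longleftrightarrow>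
     (\<forall>\<phi> vs. test_function \<Omega> \<phi> \<and> length vs = Suc k \<longrightarrow>
        (\<integral>x. du x vs * \<phi> x \<partial>lebesgue_on \<Omega>) =
        - (\<Sum>i\<le>k. (-1) ^ i *
            (\<integral>x. u x (take i vs @ drop (Suc i) vs) * frechet_derivative \<phi> (at x) (vs ! i)
               \<partial>lebesgue_on \<Omega>)))"

definition Wp_forms :: "ennreal \<Rightarrow> nat \<Rightarrow> 'a::euclidean_space set \<Rightarrow> ('a \<Rightarrow> 'a covector) set" where
  "Wp_forms p k \<Omega> =
     {u \<in> Lp_forms p k \<Omega>. \<exists>du \<in> Lp_forms p (Suc k) \<Omega>. has_weak_exterior_derivative \<Omega> k u du}"

section \<open>The constants\<close>

text \<open>
  Chains \<open>m = i\<^sub>L > \<dots> > i\<^sub>1 \<ge> l\<close> are represented as the lists \<open>[i\<^sub>L, \<dots>, i\<^sub>1]\<close>.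
\<close>

definition chains :: "nat \<Rightarrow> nat \<Rightarrow> nat list set" where
  "chains m l = {is. is \<noteq> [] \<and> sorted_wrt (>) is \<and> hd is = m \<and> l \<le> last is}"

lemma finite_chains: "finite (chains m l)"
proof (rule finite_subset)
  show "chains m l \<subseteq> {xs. set xs \<subseteq> {..m} \<and> distinct xs}"
  proof
    fix xs assume xs: "xs \<in> chains m l"
    then obtain ys where ys: "xs = m # ys" "sorted_wrt (>) xs"
      by (cases xs) (auto simp: chains_def)
    have "distinct xs"
      using ys(2) by (induction xs) auto
    with ys show "xs \<in> {xs. set xs \<subseteq> {..m} \<and> distinct xs}"
      by auto
  qed
  show "finite {xs. set xs \<subseteq> {..m} \<and> distinct xs}"
    by (rule finite_subset_distinct) simp
qed

lemma chains_empty: "m < l \<Longrightarrow> chains m l = {}"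
proof -
  have "last is \<le> hd is" if "is \<noteq> []" "sorted_wrt (>) is" for "is" :: "nat list"
    using that by (cases "is") (auto simp: less_imp_le)
  then show "m < l \<Longrightarrow> chains m l = {}"
    by (fastforce simp: chains_def)
qed

definition chain_const :: "(nat \<Rightarrow> nat \<Rightarrow> real) \<Rightarrow> (nat \<Rightarrow> nat \<Rightarrow> real) \<Rightarrow> nat \<Rightarrow> nat \<Rightarrow> real" where
  "chain_const A B m l =
     (\<Sum>is\<in>chains m l. (\<Prod>j<length is - 1. B (is ! j) (is ! Suc j)) * A (last is) l)"

text \<open>The mixed \<open>\<ell>\<^sup>p(\<ell>\<^sup>q)\<close> norm of the constants; \<open>q\<close> is the exponent conjugate to \<open>p\<close>.\<close>

definition shelling_const :: "ennreal \<Rightarrow> ennreal \<Rightarrow> nat \<Rightarrow> (nat \<Rightarrow> nat \<Rightarrow> real) \<Rightarrow> real" where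
  "shelling_const p q M C =
     (if p = 1 then \<Sum>m\<le>M. Max ((\<lambda>l. C m l) ` {..M})
      else if p = \<infinity> then Max ((\<lambda>m. \<Sum>l\<le>M. C m l) ` {..M})
      else (\<Sum>m\<le>M. (\<Sum>l\<le>M. C m l powr enn2real q) powr (enn2real p / enn2real q))
             powr (1 / enn2real p))"

end

theory Submission
  imports Defs
begin

text \<open>
  Only the estimates on the individual simplices matter. The simplices of a shelling cover \<open>\<Omega>\<close> up
  to a null set and overlap in null sets, so the \<open>L\<^sup>p\<close> norm over \<open>\<Omega>\<close> is the \<open>\<ell>\<^sup>p\<close> norm of the norms
  over the simplices. Substituting the recursive estimates into each other bounds the norm of \<open>w\<close>
  over \<open>T m\<close> by the sum over \<open>l\<close> of \<open>C m l\<close> times the norm of \<open>du\<close> over \<open>T l\<close>, and the Hoelder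
  inequality in \<open>l\<close>, followed by the \<open>\<ell>\<^sup>p\<close> norm in \<open>m\<close>, gives the claim.
\<close>

section \<open>Chains and the recursion they solve\<close>

text \<open>A chain is either the single index \<open>m\<close>, admissible when
  \<open>l \<le> m\<close>, or \<open>m\<close> followed by a chain with a smaller head
  \<open>j\<close>.\<close>

lemma chains_rec:
  "chains m l = (if l \<le> m then {[m]} else {}) \<union> (\<Union>j<m. (#) m ` chains j l)"
proof (intro set_eqI iffI)
  fix xs assume "xs \<in> chains m l"
  then obtain ys where ys: "xs = m # ys" "sorted_wrt (>) (m # ys)" "l \<le> last (m # ys)"
    by (cases xs) (auto simp: chains_def)
  show "xs \<in> (if l \<le> m then {[m]} else {}) \<union> (\<Union>j<m. (#) m ` chains j l)"
  proof (cases ys)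
    case Nil
    with ys show ?thesis by auto
  next
    case (Cons j zs)
    with ys have "ys \<in> chains j l" "j < m" by (auto simp: chains_def)
    with ys(1) show ?thesis by auto
  qed
next
  fix xs assume "xs \<in> (if l \<le> m then {[m]} else {}) \<union> (\<Union>j<m. (#) m ` chains j l)"
  then consider "l \<le> m" "xs = [m]" | j ys where "j < m" "ys \<in> chains j l" "xs = m # ys"
    by (auto split: if_splits)
  then show "xs \<in> chains m l"
  proof cases
    case (2 j ys)
    then obtain zs where "ys = j # zs"
      by (cases ys) (auto simp: chains_def)
    with 2 show ?thesis by (auto simp: chains_def)
  qed (auto simp: chains_def)
qed

text \<open>Putting \<open>m\<close> in front of a chain with head \<open>j\<close> multiplies its
  product by \<open>B m j\<close> and leaves the last index, hence the \<open>A\<close> factor,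
  unchanged. The pieces of \<open>chains_rec\<close> are disjoint, because the second entry of a
  list determines \<open>j\<close>.\<close>

lemma chain_const_rec:
  "chain_const A B m l = (if l \<le> m then A m l else 0) + (\<Sum>j<m. B m j * chain_const A B j l)"
proof -
  let ?f = "\<lambda>is. (\<Prod>j<length is - 1. B (is ! j) (is ! Suc j)) * A (last is) l"
  have hd: "is \<noteq> []" "hd is = j" if "is \<in> chains j l" for "is" j
    using that by (auto simp: chains_def)
  have step: "?f (m # is) = B m j * ?f is" if "is \<in> chains j l" for "is" j
  proof -
    \<comment> \<open>Since the tail is non-empty, prepending \<open>m\<close> lengthens the index
      range of the product by one. The shift then splits off the factor at index 0, which is
      \<open>B m j\<close>.\<close>
    from hd[OF that] obtain js where js: "is = j # js" by (cases "is") auto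
    show ?thesis by (simp add: js prod.lessThan_Suc_shift del: prod.lessThan_Suc)
  qed
  have "chain_const A B m l =
      sum ?f (if l \<le> m then {[m]} else {}) + sum ?f (\<Union>j<m. (#) m ` chains j l)"
    unfolding chain_const_def chains_rec[of m]
    by (rule sum.union_disjoint) (auto simp: finite_chains dest: hd)
  also have "sum ?f (\<Union>j<m. (#) m ` chains j l) = (\<Sum>j<m. sum ?f ((#) m ` chains j l))"
    by (rule sum.UNION_disjoint) (auto simp: finite_chains dest: hd)
  also have "\<dots> = (\<Sum>j<m. B m j * chain_const A B j l)"
  proof (rule sum.cong[OF refl])
    fix j
    have "sum ?f ((#) m ` chains j l) = (\<Sum>is\<in>chains j l. ?f (m # is))"
      by (subst sum.reindex) auto
    also have "\<dots> = (\<Sum>is\<in>chains j l. B m j * ?f is)"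
      by (rule sum.cong[OF refl]) (rule step)
    finally show "sum ?f ((#) m ` chains j l) = B m j * chain_const A B j l"
      by (simp add: chain_const_def sum_distrib_left)
  qed
  finally show ?thesis by simp
qed

lemma chain_const_nonneg:
  assumes "\<And>m l. l \<le> m \<Longrightarrow> m \<le> M \<Longrightarrow> 0 \<le> A m l"
    and "\<And>m l. l < m \<Longrightarrow> m \<le> M \<Longrightarrow> 0 \<le> B m l"
    and "m \<le> M"
  shows "0 \<le> chain_const A B m l"
  using assms(3)
proof (induction m rule: less_induct)
  case (less m)
  then show ?case
    by (subst chain_const_rec) (auto intro!: add_nonneg_nonneg sum_nonneg mult_nonneg_nonneg assms(1,2))
qed

text \<open>Strong induction: the bounds for \<open>W j\<close> with \<open>j < m\<close> may be
  inserted because \<open>B m j\<close> is nonnegative, and the coefficient of \<open>D l\<close>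
  collected in this way is the right-hand side of \<open>chain_const_rec\<close>.\<close>

lemma recursive_estimate:
  fixes W D :: "nat \<Rightarrow> real"
  assumes B: "\<And>m l. l < m \<Longrightarrow> m \<le> M \<Longrightarrow> 0 \<le> B m l"
    and W: "\<And>m. m \<le> M \<Longrightarrow> W m \<le> (\<Sum>l\<le>m. A m l * D l) + (\<Sum>l<m. B m l * W l)"
    and "m \<le> M"
  shows "W m \<le> (\<Sum>l\<le>M. chain_const A B m l * D l)"
  using \<open>m \<le> M\<close>
proof (induction m rule: less_induct)
  case (less m)
  have "W m \<le> (\<Sum>l\<le>m. A m l * D l) + (\<Sum>j<m. B m j * W j)"
    using W less.prems by blast
  also have "(\<Sum>j<m. B m j * W j) \<le> (\<Sum>j<m. B m j * (\<Sum>l\<le>M. chain_const A B j l * D l))"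
    using less B by (intro sum_mono mult_left_mono) auto
  also have "\<dots> = (\<Sum>l\<le>M. (\<Sum>j<m. B m j * chain_const A B j l) * D l)"
    unfolding sum_distrib_left sum_distrib_right by (subst sum.swap) (simp add: mult.assoc)
  \<comment> \<open>Padding with zeros up to \<open>M\<close> produces the conditional term of the
    recursion.\<close>
  also have "(\<Sum>l\<le>m. A m l * D l) = (\<Sum>l\<le>M. (if l \<le> m then A m l else 0) * D l)"
    using less.prems by (intro sum.mono_neutral_cong_left) auto
  finally show ?case
    by (subst chain_const_rec) (simp add: distrib_right sum.distrib)
qed

section \<open>Mixed norms of matrices\<close>

text \<open>Both families are divided by their norms \<open>F\<close> and \<open>G\<close>; Young's
  inequality, applied to each product and summed, then gives the bound
  \<open>1 / s + 1 / r = 1\<close>.\<close>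

lemma Holder_sum:
  fixes f g :: "'b \<Rightarrow> real"
  assumes r: "1 < r" and s: "1 < s" and rs: "1 / r + 1 / s = 1"
    and "finite I" and f: "\<And>i. i \<in> I \<Longrightarrow> 0 \<le> f i" and g: "\<And>i. i \<in> I \<Longrightarrow> 0 \<le> g i"
  shows "(\<Sum>i\<in>I. f i * g i) \<le> (\<Sum>i\<in>I. f i powr s) powr (1 / s) * (\<Sum>i\<in>I. g i powr r) powr (1 / r)"
proof -
  define F where "F = (\<Sum>i\<in>I. f i powr s) powr (1 / s)"
  define G where "G = (\<Sum>i\<in>I. g i powr r) powr (1 / r)"
  have Fs: "F powr s = (\<Sum>i\<in>I. f i powr s)" and Gr: "G powr r = (\<Sum>i\<in>I. g i powr r)"
    using r s by (simp_all add: F_def G_def powr_powr sum_nonneg)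
  show ?thesis
  proof (cases "F = 0 \<or> G = 0")
    \<comment> \<open>Normalisation is impossible here, but one of the families vanishes, so the
      left-hand side is 0.\<close>
    case True
    then have "(\<forall>i\<in>I. f i = 0) \<or> (\<forall>i\<in>I. g i = 0)"
      using \<open>finite I\<close> by (auto simp: F_def G_def sum_nonneg_eq_0_iff)
    then show ?thesis by (auto simp: sum_nonneg)
  next
    case False
    then have pos: "0 < F" "0 < G"
      by (auto simp: F_def G_def powr_ge_zero less_le)
    have "(\<Sum>i\<in>I. (f i / F) * (g i / G)) \<le>
        (\<Sum>i\<in>I. (f i / F) powr s / s + (g i / G) powr r / r)"
      using r s rs f g pos by (intro sum_mono Youngs_inequality) (auto simp: add.commute)
    also have "\<dots> = (\<Sum>i\<in>I. f i powr s) / F powr s / s + (\<Sum>i\<in>I. g i powr r) / G powr r / r"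
      using f g pos by (simp add: powr_divide sum.distrib sum_divide_distrib)
    also have "\<dots> = 1"
      using pos rs by (simp flip: Fs Gr add: add.commute)
    finally have "(\<Sum>i\<in>I. f i * g i) / (F * G) \<le> 1"
      by (simp add: sum_divide_distrib)
    then show ?thesis
      using pos by (simp add: F_def[symmetric] G_def[symmetric] divide_le_eq)
  qed
qed

text \<open>For finite \<open>p\<close> other than 1 the conjugate exponent is also finite and
  greater than 1, so the relation can be read in the reals, where Young's inequality lives.\<close>

lemma conjugate_exponents:
  fixes p q :: ennreal
  assumes "1 \<le> p" "1 / p + 1 / q = 1" "p \<noteq> 1" "p \<noteq> \<infinity>"
  shows "1 < enn2real p" "1 < enn2real q" "1 / enn2real p + 1 / enn2real q = 1"
proof -
  obtain r where r: "p = ennreal r" "0 \<le> r"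
    using \<open>p \<noteq> \<infinity>\<close> by (cases p) auto
  have "1 < r" using assms(1,3) r by (auto simp: less_le ennreal_eq_1)
  then have p1: "1 / p = ennreal (1 / r)"
    using r by (simp add: divide_ennreal flip: ennreal_1)
  \<comment> \<open>An infinite \<open>q\<close> would contribute 0 and force
    \<open>1 / r = 1\<close>.\<close>
  have "q \<noteq> \<infinity>"
    using assms(2) p1 \<open>1 < r\<close> by (auto simp: ennreal_eq_1)
  then obtain s where s: "q = ennreal s" "0 \<le> s" by (cases q) auto
  \<comment> \<open>In \<open>ennreal\<close> the quotient \<open>1 / 0\<close> is infinite, which
    is incompatible with a sum equal to 1.\<close>
  have "s \<noteq> 0" using assms(2) s by auto
  then have s0: "0 < s" using s by simp
  then have "1 / q = ennreal (1 / s)"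
    using s by (simp add: divide_ennreal flip: ennreal_1)
  then have "ennreal (1 / r + 1 / s) = 1"
    using assms(2) p1 s0 \<open>1 < r\<close> by (simp add: ennreal_plus)
  then have rs: "1 / r + 1 / s = 1" by (simp add: ennreal_eq_1)
  moreover have "0 < 1 / r" using \<open>1 < r\<close> by simp
  ultimately have "1 / s < 1" by linarith
  then have "1 < s" using s0 by simp
  with r s rs \<open>1 < r\<close>
  show "1 < enn2real p" "1 < enn2real q" "1 / enn2real p + 1 / enn2real q = 1"
    by simp_all
qed

lemma shelling_const_estimate:
  fixes W D :: "nat \<Rightarrow> real"
  assumes p: "1 \<le> p" "1 / p + 1 / q = 1" "p \<noteq> \<infinity>"
    and C: "\<And>m l. m \<le> M \<Longrightarrow> l \<le> M \<Longrightarrow> 0 \<le> C m l"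
    and W: "\<And>m. m \<le> M \<Longrightarrow> 0 \<le> W m" and D: "\<And>l. l \<le> M \<Longrightarrow> 0 \<le> D l"
    and le: "\<And>m. m \<le> M \<Longrightarrow> W m \<le> (\<Sum>l\<le>M. C m l * D l)"
  shows "(\<Sum>m\<le>M. W m powr enn2real p) powr (1 / enn2real p) \<le>
         shelling_const p q M C * (\<Sum>l\<le>M. D l powr enn2real p) powr (1 / enn2real p)"
proof (cases "p = 1")
  case True
  have "W m \<le> Max ((\<lambda>l. C m l) ` {..M}) * (\<Sum>l\<le>M. D l)" if "m \<le> M" for m
  proof -
    have "W m \<le> (\<Sum>l\<le>M. C m l * D l)" by (rule le[OF that])
    also have "\<dots> \<le> (\<Sum>l\<le>M. Max ((\<lambda>l. C m l) ` {..M}) * D l)"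
      using D by (intro sum_mono mult_right_mono Max_ge) auto
    finally show ?thesis by (simp add: sum_distrib_left)
  qed
  then have "(\<Sum>m\<le>M. W m) \<le> (\<Sum>m\<le>M. Max ((\<lambda>l. C m l) ` {..M})) * (\<Sum>l\<le>M. D l)"
    unfolding sum_distrib_right by (intro sum_mono) auto
  \<comment> \<open>At exponent 1 the powers in the claim reduce to absolute values, which
    nonnegativity removes.\<close>
  moreover have "(\<Sum>m\<le>M. \<bar>W m\<bar>) = (\<Sum>m\<le>M. W m)" "(\<Sum>l\<le>M. \<bar>D l\<bar>) = (\<Sum>l\<le>M. D l)"
    using W D by (auto intro: sum.cong)
  moreover have "0 \<le> (\<Sum>m\<le>M. W m)" "0 \<le> (\<Sum>l\<le>M. D l)"
    using W D by (auto intro: sum_nonneg)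
  ultimately show ?thesis
    using True by (simp add: shelling_const_def)
next
  case False
  define r s where "r = enn2real p" and "s = enn2real q"
  have rs: "1 < r" "1 < s" "1 / r + 1 / s = 1"
    using conjugate_exponents[OF p(1,2) False p(3)] by (simp_all add: r_def s_def)
  let ?G = "\<Sum>l\<le>M. D l powr r"
  have "W m powr r \<le> (\<Sum>l\<le>M. C m l powr s) powr (r / s) * ?G" if "m \<le> M" for m
  proof -
    have "W m \<le> (\<Sum>l\<le>M. C m l powr s) powr (1 / s) * ?G powr (1 / r)"
      using le[OF that] Holder_sum[OF rs, of "{..M}" "C m" D] C D that by fastforce
    then have "W m powr r \<le> ((\<Sum>l\<le>M. C m l powr s) powr (1 / s) * ?G powr (1 / r)) powr r"
      using W that rs by (intro powr_mono2) auto
    also have "\<dots> = (\<Sum>l\<le>M. C m l powr s) powr (r / s) * ?G"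
      using rs by (simp add: powr_mult powr_powr sum_nonneg)
    finally show ?thesis .
  qed
  then have "(\<Sum>m\<le>M. W m powr r) \<le> (\<Sum>m\<le>M. (\<Sum>l\<le>M. C m l powr s) powr (r / s)) * ?G"
    unfolding sum_distrib_right by (intro sum_mono) auto
  then have "(\<Sum>m\<le>M. W m powr r) powr (1 / r) \<le>
      ((\<Sum>m\<le>M. (\<Sum>l\<le>M. C m l powr s) powr (r / s)) * ?G) powr (1 / r)"
    using rs by (intro powr_mono2) (auto intro: sum_nonneg)
  also have "\<dots> = (\<Sum>m\<le>M. (\<Sum>l\<le>M. C m l powr s) powr (r / s)) powr (1 / r) * ?G powr (1 / r)"
    by (simp add: powr_mult sum_nonneg)
  finally show ?thesis
    using False p(3) by (simp add: shelling_const_def r_def s_def)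
qed

section \<open>Norms over almost disjoint covers\<close>

text \<open>Closed simplices stick out of the open set \<Omega> at its boundary and share faces with
  each other, so containment and disjointness are required only up to null sets.\<close>

definition ae_partition :: "'a::euclidean_space set \<Rightarrow> nat \<Rightarrow> (nat \<Rightarrow> 'a set) \<Rightarrow> bool" where
  "ae_partition \<Omega> M T \<longleftrightarrow>
     \<Omega> \<in> sets lebesgue \<and> (\<forall>m\<le>M. T m \<in> sets lebesgue \<and> negligible (T m - \<Omega>)) \<and>
     negligible (\<Omega> - (\<Union>m\<le>M. T m)) \<and> pairwise (\<lambda>i j. negligible (T i \<inter> T j)) {..M}"

text \<open>The relation \<open>has_integral\<close> is additive over finite unions with negligible
  overlaps and insensitive to null changes of the domain; the Lebesgue integrals are therefore
  compared through it.\<close>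

lemma ae_partition_integral:
  fixes f :: "'a::euclidean_space \<Rightarrow> real"
  assumes part: "ae_partition \<Omega> M T" and f: "integrable (lebesgue_on \<Omega>) f"
  shows "(\<integral>x. f x \<partial>lebesgue_on \<Omega>) = (\<Sum>m\<le>M. \<integral>x. f x \<partial>lebesgue_on (T m))"
proof -
  have \<Omega>: "\<Omega> \<in> sets lebesgue"
    using part by (simp add: ae_partition_def)
  have T: "T m \<in> sets lebesgue" "negligible (T m - \<Omega>)" if "m \<le> M" for m
    using part that by (auto simp: ae_partition_def)
  have abs: "f absolutely_integrable_on \<Omega>"
    using f \<Omega> by (simp add: set_integrable_def integrable_restrict_space)
  have fT: "integrable (lebesgue_on (T m)) f" if "m \<le> M" for m
  proof -
    have "f absolutely_integrable_on (\<Omega> \<inter> T m)"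
      using abs \<Omega> T(1)[OF that] by (auto intro: set_integrable_subset)
    then have "f absolutely_integrable_on T m"
      by (rule absolutely_integrable_spike_set)
        (auto intro: negligible_subset[OF T(2)[OF that]] empty_imp_negligible)
    then show ?thesis
      using T(1)[OF that] by (simp add: set_integrable_def integrable_restrict_space)
  qed
  have "(f has_integral (\<Sum>m\<le>M. \<integral>x. f x \<partial>lebesgue_on (T m))) (\<Union>m\<in>{..M}. T m)"
    using part fT T
    by (intro has_integral_UN has_integral_integral_lebesgue_on) (auto simp: ae_partition_def)
  moreover have "negligible ((\<Union>m\<le>M. T m) - \<Omega>)"
    using T by (auto simp: UN_extend_simps simp del: UN_simps intro!: negligible_Union)
  ultimately have "(f has_integral (\<Sum>m\<le>M. \<integral>x. f x \<partial>lebesgue_on (T m))) \<Omega>"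
    using part
    by (subst has_integral_spike_set_eq[of \<Omega> "\<Union>m\<le>M. T m"])
       (auto simp: ae_partition_def intro: negligible_subset)
  moreover have "(f has_integral (\<integral>x. f x \<partial>lebesgue_on \<Omega>)) \<Omega>"
    using f \<Omega> by (intro has_integral_integral_lebesgue_on) auto
  ultimately show ?thesis
    by (rule has_integral_unique[symmetric])
qed

text \<open>Nothing is known about \<open>f\<close> on \<open>T m - \<Omega>\<close>, but this set
  is null, and \<open>measurable_on\<close> is stable under null changes of the domain.\<close>

lemma ae_partition_borel_measurable:
  fixes f :: "'a::euclidean_space \<Rightarrow> real"
  assumes part: "ae_partition \<Omega> M T" and f: "f \<in> borel_measurable (lebesgue_on \<Omega>)" and "m \<le> M"
  shows "f \<in> borel_measurable (lebesgue_on (T m))"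
proof -
  have sets: "\<Omega> \<in> sets lebesgue" "T m \<in> sets lebesgue" "negligible (T m - \<Omega>)"
    using part \<open>m \<le> M\<close> by (auto simp: ae_partition_def)
  have "f \<in> borel_measurable (lebesgue_on (\<Omega> \<inter> T m))"
    using f by (rule measurable_restrict_mono) auto
  then have "f measurable_on (\<Omega> \<inter> T m)"
    using sets by (simp add: measurable_on_iff_borel_measurable)
  moreover have "negligible ((\<Omega> \<inter> T m - T m) \<union> (T m - \<Omega> \<inter> T m))"
    by (rule negligible_subset[OF sets(3)]) auto
  ultimately have "f measurable_on T m"
    by (rule measurable_on_spike_set)
  then show ?thesis
    using sets by (simp add: measurable_on_iff_borel_measurable)
qed

lemma AE_lebesgue_on_iff:
  "S \<in> sets lebesgue \<Longrightarrow> (AE x in lebesgue_on S. P x) \<longleftrightarrow> negligible {x \<in> S. \<not> P x}"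
  by (simp add: AE_restrict_space_iff completion.AE_iff_null_sets negligible_iff_null_sets)

text \<open>Up to null sets, the exceptional set on each \<open>T m\<close> lies in that on
  \<Omega>, and the latter lies in the finite union of the former. This carries essential bounds
  between \<Omega> and the simplices when \<open>p = \<infinity>\<close>.\<close>

lemma ae_partition_AE_iff:
  assumes part: "ae_partition \<Omega> M T"
  shows "(AE x in lebesgue_on \<Omega>. P x) \<longleftrightarrow> (\<forall>m\<le>M. AE x in lebesgue_on (T m). P x)"
proof -
  have \<Omega>: "\<Omega> \<in> sets lebesgue" "negligible (\<Omega> - (\<Union>m\<le>M. T m))"
    using part by (auto simp: ae_partition_def)
  have T: "T m \<in> sets lebesgue" "negligible (T m - \<Omega>)" if "m \<le> M" for m
    using part that by (auto simp: ae_partition_def)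
  show ?thesis
  proof (intro iffI allI impI)
    fix m assume "AE x in lebesgue_on \<Omega>. P x" "m \<le> M"
    then have "negligible ({x \<in> \<Omega>. \<not> P x} \<union> (T m - \<Omega>))"
      using \<Omega> T by (simp add: AE_lebesgue_on_iff)
    then have "negligible {x \<in> T m. \<not> P x}"
      by (rule negligible_subset) auto
    then show "AE x in lebesgue_on (T m). P x"
      using T \<open>m \<le> M\<close> by (simp add: AE_lebesgue_on_iff)
  next
    assume "\<forall>m\<le>M. AE x in lebesgue_on (T m). P x"
    then have "\<forall>m\<le>M. negligible {x \<in> T m. \<not> P x}"
      using T by (simp add: AE_lebesgue_on_iff)
    then have "negligible (\<Union>m\<le>M. {x \<in> T m. \<not> P x})"
      by (auto intro!: negligible_Union)
    then have "negligible ((\<Union>m\<le>M. {x \<in> T m. \<not> P x}) \<union> (\<Omega> - (\<Union>m\<le>M. T m)))"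
      using \<Omega> by simp
    then have "negligible {x \<in> \<Omega>. \<not> P x}"
      by (rule negligible_subset) auto
    then show "AE x in lebesgue_on \<Omega>. P x"
      using \<Omega> by (simp add: AE_lebesgue_on_iff)
  qed
qed

section \<open>L^p norms of forms, for finite and infinite exponent\<close>

lemma covector_norm_nonneg: "0 \<le> covector_norm k \<omega>"
  by (simp add: covector_norm_def sum_nonneg)

lemma Lp_forms_measurable:
  assumes "u \<in> Lp_forms p k S"
  shows "(\<lambda>x. covector_norm k (u x)) \<in> borel_measurable (lebesgue_on S)"
proof -
  have [measurable]: "(\<lambda>x. u x vs) \<in> borel_measurable (lebesgue_on S)" for vs
    using assms by (simp add: Lp_forms_def)
  show ?thesis unfolding covector_norm_def by measurable
qed

lemma Lp_norm_powr:
  assumes "1 \<le> p" "p \<noteq> \<infinity>"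
  shows "Lp_norm p k S u powr enn2real p =
           (\<integral>x. covector_norm k (u x) powr enn2real p \<partial>lebesgue_on S)"
proof -
  have "p \<noteq> 0" using assms(1) by auto
  \<comment> \<open>\<open>enn2real\<close> vanishes at 0 and at \<infinity>; with both excluded,
    the root and the power cancel.\<close>
  then have "enn2real p \<noteq> 0" using assms(2) by (simp add: enn2real_eq_0_iff)
  then show ?thesis
    using assms(2) by (simp add: Lp_norm_def powr_powr)
qed

lemma Lp_norm_ae_partition:
  assumes part: "ae_partition \<Omega> M T" and u: "u \<in> Lp_forms p k \<Omega>" and p: "1 \<le> p" "p \<noteq> \<infinity>"
  shows "Lp_norm p k \<Omega> u = (\<Sum>m\<le>M. Lp_norm p k (T m) u powr enn2real p) powr (1 / enn2real p)"
proof -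
  have "integrable (lebesgue_on \<Omega>) (\<lambda>x. covector_norm k (u x) powr enn2real p)"
    using u p by (simp add: Lp_forms_def)
  from ae_partition_integral[OF part this] show ?thesis
    unfolding Lp_norm_powr[OF p] using p(2) by (simp add: Lp_norm_def)
qed

text \<open>The essential supremum is \<open>-\<infinity>\<close> on a null domain, and
  \<open>real_of_ereal\<close> sends it to 0; the assumption \<open>0 \<le> c\<close> covers this
  case.\<close>

lemma Linf_norm_le:
  assumes "(\<lambda>x. covector_norm k (u x)) \<in> borel_measurable (lebesgue_on S)"
    and "AE x in lebesgue_on S. covector_norm k (u x) \<le> c" and "0 \<le> c"
  shows "Lp_norm \<infinity> k S u \<le> c"
proof -
  have "esssup (lebesgue_on S) (\<lambda>x. ereal (covector_norm k (u x))) \<le> ereal c"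
    using assms by (intro esssup_I) auto
  then show ?thesis
    using \<open>0 \<le> c\<close>
    by (cases "esssup (lebesgue_on S) (\<lambda>x. ereal (covector_norm k (u x)))") (auto simp: Lp_norm_def)
qed

text \<open>The bound \<open>c\<close> only serves to make the essential supremum differ from
  \<open>\<infinity>\<close>, which \<open>real_of_ereal\<close> would turn into 0.\<close>

lemma AE_le_Linf_norm:
  assumes meas: "(\<lambda>x. covector_norm k (u x)) \<in> borel_measurable (lebesgue_on S)"
    and bd: "AE x in lebesgue_on S. covector_norm k (u x) \<le> c"
  shows "AE x in lebesgue_on S. covector_norm k (u x) \<le> Lp_norm \<infinity> k S u"
proof -
  let ?e = "esssup (lebesgue_on S) (\<lambda>x. ereal (covector_norm k (u x)))"
  have "?e \<le> ereal c"
    using assms by (intro esssup_I) auto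
  moreover have "AE x in lebesgue_on S. ereal (covector_norm k (u x)) \<le> ?e"
    by (rule esssup_AE)
  ultimately show ?thesis
    by (cases ?e) (auto simp: Lp_norm_def)
qed

lemma Lp_norm_nonneg:
  assumes "(\<lambda>x. covector_norm k (u x)) \<in> borel_measurable (lebesgue_on S)"
  shows "0 \<le> Lp_norm p k S u"
proof (cases "p = \<infinity>")
  case True
  let ?e = "esssup (lebesgue_on S) (\<lambda>x. ereal (covector_norm k (u x)))"
  show ?thesis
  proof (rule ccontr)
    assume "\<not> ?thesis"
    then obtain r where r: "?e = ereal r" "r < 0"
      using True by (cases ?e) (auto simp: Lp_norm_def)
    have "AE x in lebesgue_on S. ereal (covector_norm k (u x)) \<le> ereal r"
      using esssup_AE[of "\<lambda>x. ereal (covector_norm k (u x))" "lebesgue_on S"] r by simp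
    \<comment> \<open>A bound by a negative number fails at every point, so it implies the smaller
      bound \<open>r - 1\<close> as well, against the minimality of the essential supremum.\<close>
    then have "AE x in lebesgue_on S. ereal (covector_norm k (u x)) \<le> ereal (r - 1)"
    proof (rule AE_mp, intro AE_I2 impI)
      fix x assume "ereal (covector_norm k (u x)) \<le> ereal r"
      then show "ereal (covector_norm k (u x)) \<le> ereal (r - 1)"
        using r(2) covector_norm_nonneg[of k "u x"] by simp
    qed
    then have "?e \<le> ereal (r - 1)"
      using assms by (intro esssup_I) auto
    then show False using r by simp
  qed
qed (simp add: Lp_norm_def)

section \<open>Shellings as almost disjoint covers\<close>

text \<open>The full-dimensional simplices cover because every member lies in one of them. What they
  lose to the interior lies in frontiers of convex sets, and two of them meet in a common face of
  lower dimension.\<close>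

lemma shelling_ae_partition:
  fixes \<T> :: "'a::euclidean_space set set"
  assumes \<T>: "dimensional_triangulation DIM('a) \<T>" and sh: "shelling \<T> M T"
  shows "ae_partition (interior (\<Union>\<T>)) M T"
proof -
  have cx: "simplicial_complex (insert {} \<T>)"
    using \<T> by (simp add: dimensional_triangulation_def simplicial_triangulation_def)
  have bij: "bij_betw T {..M} {S \<in> \<T>. int DIM('a) simplex S}"
    using sh by (simp add: shelling_def)
  have T: "T m \<in> \<T>" "int DIM('a) simplex T m" if "m \<le> M" for m
    using bij_betw_apply[OF bij, of m] that by auto
  have cover: "\<Union>\<T> = (\<Union>m\<le>M. T m)"
  proof
    show "\<Union>\<T> \<subseteq> (\<Union>m\<le>M. T m)"
    proof
      fix x assume "x \<in> \<Union>\<T>"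
      then obtain S where "S \<in> \<T>" "int DIM('a) simplex S" "x \<in> S"
        using \<T> unfolding dimensional_triangulation_def by blast
      then show "x \<in> (\<Union>m\<le>M. T m)"
        using bij_betw_imp_surj_on[OF bij] by blast
    qed
  qed (use T in auto)
  have "negligible (T m - interior (\<Union>\<T>))" if "m \<le> M" for m
  proof -
    have "interior (T m) \<subseteq> interior (\<Union>\<T>)"
      using T(1)[OF that] by (intro interior_mono) auto
    then have "T m - interior (\<Union>\<T>) \<subseteq> frontier (T m)"
      using closure_subset[of "T m"] by (auto simp: frontier_def)
    then show ?thesis
      using negligible_convex_frontier[OF convex_simplex[OF T(2)[OF that]]] negligible_subset by blast
  qed
  moreover have "T m \<in> sets lebesgue" if "m \<le> M" for m
    using closed_simplex[OF T(2)[OF that]] by (simp add: lebesgue_closedin borel_closed)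
  moreover have "negligible (interior (\<Union>\<T>) - (\<Union>m\<le>M. T m))"
    using interior_subset[of "\<Union>\<T>"] unfolding cover by (intro empty_imp_negligible) auto
  moreover have "negligible (T i \<inter> T j)" if "i \<le> M" "j \<le> M" "i \<noteq> j" for i j
  proof -
    have "(T i \<inter> T j) face_of T i" "(T j \<inter> T i) face_of T j"
      using cx T(1) that by (auto simp: simplicial_complex_def)
    then have faces: "(T i \<inter> T j) face_of T i" "(T i \<inter> T j) face_of T j"
      by (simp_all add: Int_commute)
    have dim: "aff_dim (T i) = DIM('a)" "aff_dim (T j) = DIM('a)"
      using T(2) that by (auto simp: aff_dim_simplex)
    have "T i \<noteq> T j"
      using bij that by (auto simp: bij_betw_def inj_on_def)
    \<comment> \<open>The common face is proper in at least one of the two simplices, and a proper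
      face has smaller dimension.\<close>
    then have "T i \<inter> T j \<noteq> T i \<or> T i \<inter> T j \<noteq> T j" by auto
    then have "aff_dim (T i \<inter> T j) < DIM('a)"
      using face_of_aff_dim_lt[OF convex_simplex[OF T(2)]] faces dim that by metis
    then have "interior (T i \<inter> T j) = {}"
      by (intro low_dim_interior) auto
    moreover have "convex (T i \<inter> T j)"
      using T(2) that by (intro convex_Int convex_simplex)
    ultimately show ?thesis
      by (simp add: negligible_convex_interior)
  qed
  ultimately show ?thesis
    by (auto simp: ae_partition_def pairwise_def)
qed

section \<open>The estimate on the whole domain\<close>

theorem theorem9p4:
  fixes \<T> :: "'a::euclidean_space set set"
    and \<Omega> :: "'a set"
    and T :: "nat \<Rightarrow> 'a set"
    and M k :: nat
    and p q :: ennreal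
    and u w du dw :: "'a \<Rightarrow> 'a covector"
    and A B :: "nat \<Rightarrow> nat \<Rightarrow> real"
  assumes "dimensional_triangulation DIM('a) \<T>"
    and "shellable \<T>"
    and "\<Omega> = interior (\<Union>\<T>)"
    and "shelling \<T> M T"
    and "1 \<le> p" and "1 \<le> q" and "1 / p + 1 / q = 1"
    and "u \<in> Wp_forms p k \<Omega>"
    and "w \<in> Wp_forms p k \<Omega>"
    and "du \<in> Lp_forms p (Suc k) \<Omega>" and "has_weak_exterior_derivative \<Omega> k u du"
    and "dw \<in> Lp_forms p (Suc k) \<Omega>" and "has_weak_exterior_derivative \<Omega> k w dw"
    and "AE x in lebesgue_on \<Omega>. dw x = du x"
    and "\<And>m l. l \<le> m \<Longrightarrow> m \<le> M \<Longrightarrow> 0 \<le> A m l"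
    and "\<And>m l. l < m \<Longrightarrow> m \<le> M \<Longrightarrow> 0 \<le> B m l"
    and "Lp_norm p k (T 0) w \<le> A 0 0 * Lp_norm p (Suc k) (T 0) du"
    and "\<And>m. 1 \<le> m \<Longrightarrow> m \<le> M \<Longrightarrow>
           Lp_norm p k (T m) w \<le>
             (\<Sum>l\<le>m. A m l * Lp_norm p (Suc k) (T l) du) + (\<Sum>l<m. B m l * Lp_norm p k (T l) w)"
  shows "Lp_norm p k \<Omega> w \<le>
           shelling_const p q M (chain_const A B) * Lp_norm p (Suc k) \<Omega> du"
proof -
  define C where "C = chain_const A B"
  define W where "W = (\<lambda>m. Lp_norm p k (T m) w)"
  define D where "D = (\<lambda>m. Lp_norm p (Suc k) (T m) du)"
  have part: "ae_partition \<Omega> M T"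
    using shelling_ae_partition assms(1,3,4) by blast
  have w: "w \<in> Lp_forms p k \<Omega>"
    using assms(9) by (simp add: Wp_forms_def)
  note du = \<open>du \<in> Lp_forms p (Suc k) \<Omega>\<close>
  note meas_w = Lp_forms_measurable[OF w] and meas_du = Lp_forms_measurable[OF du]
  note meas_T = ae_partition_borel_measurable[OF part]
  have W: "0 \<le> W m" and D: "0 \<le> D m" if "m \<le> M" for m
    using meas_T[OF meas_w that] meas_T[OF meas_du that]
    by (simp_all add: W_def D_def Lp_norm_nonneg)
  have C: "0 \<le> C m l" if "m \<le> M" for m l
    unfolding C_def by (rule chain_const_nonneg[OF assms(15,16) that])
  \<comment> \<open>The bound on \<open>T 0\<close> is the case \<open>m = 0\<close>, in which the
    sum with \<open>B\<close> is empty.\<close>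
  have "W m \<le> (\<Sum>l\<le>m. A m l * D l) + (\<Sum>l<m. B m l * W l)" if "m \<le> M" for m
    using assms(17) assms(18)[of m] that by (cases "m = 0") (simp_all add: W_def D_def)
  then have le: "W m \<le> (\<Sum>l\<le>M. C m l * D l)" if "m \<le> M" for m
    unfolding C_def using assms(16) that by (intro recursive_estimate) auto
  show ?thesis
  proof (cases "p = \<infinity>")
    case False
    then show ?thesis
      using shelling_const_estimate[OF assms(5,7) False C W D le]
      by (simp add: Lp_norm_ae_partition[OF part w assms(5)]
          Lp_norm_ae_partition[OF part du assms(5)] C_def W_def D_def)
  next
    case True
    \<comment> \<open>For \<open>p = \<infinity>\<close> the claim becomes an almost everywhere
      bound of \<open>w\<close> by \<open>K * N\<close>, with \<open>K\<close> the largest row sum;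
      it is proved on each simplex and then transferred to \<Omega>.\<close>
    define K where "K = Max ((\<lambda>m. \<Sum>l\<le>M. C m l) ` {..M})"
    define N where "N = Lp_norm p (Suc k) \<Omega> du"
    obtain b c where
      bd_w: "AE x in lebesgue_on \<Omega>. covector_norm k (w x) \<le> b" and
      bd_du: "AE x in lebesgue_on \<Omega>. covector_norm (Suc k) (du x) \<le> c"
      using w du True by (auto simp: Lp_forms_def)
    have N: "0 \<le> N"
      unfolding N_def by (rule Lp_norm_nonneg[OF meas_du])
    have K: "(\<Sum>l\<le>M. C m l) \<le> K" if "m \<le> M" for m
      unfolding K_def using that by (intro Max_ge) auto
    \<comment> \<open>Together with \<open>N\<close> this gives the side condition
      \<open>0 \<le> K * N\<close> of \<open>Linf_norm_le\<close>.\<close>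
    have K0: "0 \<le> K"
      using K[of 0] C sum_nonneg[of "{..M}" "C 0"] by force
    have DN: "D l \<le> N" if "l \<le> M" for l
    proof -
      have "AE x in lebesgue_on (T l). covector_norm (Suc k) (du x) \<le> N"
        using AE_le_Linf_norm[OF meas_du bd_du] that True
        unfolding ae_partition_AE_iff[OF part] N_def by blast
      then show ?thesis
        unfolding D_def True using meas_T[OF meas_du that] N by (intro Linf_norm_le)
    qed
    have "AE x in lebesgue_on (T m). covector_norm k (w x) \<le> K * N" if "m \<le> M" for m
    proof -
      have "W m \<le> (\<Sum>l\<le>M. C m l * D l)" by (rule le[OF that])
      also have "\<dots> \<le> (\<Sum>l\<le>M. C m l * N)"
        using C that DN by (intro sum_mono mult_left_mono) auto
      also have "\<dots> \<le> K * N"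
        using K[OF that] N by (simp add: mult_right_mono flip: sum_distrib_right)
      finally have "W m \<le> K * N" .
      \<comment> \<open>The bound \<open>b\<close> on \<Omega> restricts to \<open>T m\<close>, so
        the norm there is a genuine essential bound.\<close>
      moreover have "AE x in lebesgue_on (T m). covector_norm k (w x) \<le> W m"
        using AE_le_Linf_norm[OF meas_T[OF meas_w that], of b] bd_w that True
        unfolding ae_partition_AE_iff[OF part] W_def by blast
      ultimately show ?thesis by auto
    qed
    then have "AE x in lebesgue_on \<Omega>. covector_norm k (w x) \<le> K * N"
      by (simp add: ae_partition_AE_iff[OF part])
    then have "Lp_norm \<infinity> k \<Omega> w \<le> K * N"
      using meas_w K0 N by (intro Linf_norm_le) auto
    then show ?thesis
      using True by (simp add: shelling_const_def K_def N_def C_def)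
  qed
qed

end
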